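(* Let $\boldsymbol i=(i_1,i_2,i_3)\in\{(1,2,1),(2,1,2)\}$ and $\boldsymbol a=(a,b,c)$ with $a,b,c$ positive integers. Then the monomial $E_{\boldsymbol i}^{(\boldsymbol a)}=E_{i_1}^{(a)}E_{i_2}^{(b)}E_{i_3}^{(c)}$ in $\mathbf U_v^+(\widehat{\mathfrak{sl}}_2)$ is tight if and only if $2b\ge a+c$.
   Context: $\mathbf U_v^+(\widehat{\mathfrak{sl}}_2)$ is the positive part of the quantum affine algebra of $\widehat{\mathfrak{sl}}_2$ over $\mathbb Q(v)$: it is generated by $E_1,E_2$ subject to the quantum Serre relations for the generalized Cartan matrix $\begin{pmatrix}2&-2\\-2&2\end{pmatrix}$. The divided powers are $E_i^{(m)}=E_i^m/[m]!$, with $[m]=(v^m-v^{-m})/(v-v^{-1})$ and $[m]!=[1][2]\cdots[m]$. A monomial $E_{i_1}^{(a_1)}\cdots E_{i_t}^{(a_t)}$ in divided powers is called tight if it belongs to (Lusztig's) canonical basis of $\mathbf U_v^+(\widehat{\mathfrak{sl}}_2)$. *)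

theory Defs
  imports
    "HOL-Computational_Algebra.Polynomial_Factorial"
    "HOL-Library.Poly_Mapping"
begin

section \<open>The field \<open>\<rat>(v)\<close> and its bar involution\<close>

type_synonym qv = "rat poly fract"

abbreviation qv_of_rat :: "rat \<Rightarrow> qv" where
  "qv_of_rat c \<equiv> to_fract [:c:]"

definition vv :: qv where
  "vv = to_fract [:0, 1:]"

definition subst_inv :: "rat poly \<Rightarrow> qv" where
  "subst_inv p = poly (map_poly qv_of_rat p) (inverse vv)"

lemma vv_nonzero [simp]: "vv \<noteq> 0"
  by (simp add: vv_def)

lemma qv_of_rat_add: "qv_of_rat (a + b) = qv_of_rat a + qv_of_rat b"
  by (simp flip: to_fract_add)

lemma qv_of_rat_mult: "qv_of_rat (a * b) = qv_of_rat a * qv_of_rat b"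
  by (simp flip: to_fract_mult)

lemma subst_inv_0 [simp]: "subst_inv 0 = 0"
  by (simp add: subst_inv_def)

lemma subst_inv_pCons: "subst_inv (pCons a p) = qv_of_rat a + inverse vv * subst_inv p"
  by (simp add: subst_inv_def map_poly_pCons)

lemma subst_inv_add: "subst_inv (p + q) = subst_inv p + subst_inv q"
  by (induction p q rule: poly_induct2)
     (simp_all add: subst_inv_pCons qv_of_rat_add algebra_simps)

lemma subst_inv_smult: "subst_inv (smult c p) = qv_of_rat c * subst_inv p"
  by (induction p) (simp_all add: subst_inv_pCons qv_of_rat_mult algebra_simps)

lemma subst_inv_mult: "subst_inv (p * q) = subst_inv p * subst_inv q"
  by (induction p)
     (simp_all add: subst_inv_pCons subst_inv_add subst_inv_smult algebra_simps)

lemma subst_inv_minus: "subst_inv (- p) = - subst_inv p"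
  using subst_inv_add[of p "- p"] by (simp add: eq_neg_iff_add_eq_0 add.commute)

lemma poly_qv_vv: "poly (map_poly qv_of_rat p) vv = to_fract p"
proof (induction p)
  case (pCons a p)
  have "to_fract (pCons a p) = to_fract ([:a:] + [:0, 1:] * p)" by simp
  then have "to_fract (pCons a p) = qv_of_rat a + vv * to_fract p"
    by (simp only: to_fract_add to_fract_mult vv_def)
  then show ?case using pCons by (simp add: map_poly_pCons)
qed simp

lemma subst_inv_eq_0_iff [simp]: "subst_inv p = 0 \<longleftrightarrow> p = 0"
proof
  assume A: "subst_inv p = 0"
  have "reflect_poly (map_poly qv_of_rat p) = map_poly qv_of_rat (reflect_poly p)"
    by (intro poly_eqI) (simp add: coeff_reflect_poly coeff_map_poly degree_map_poly)
  then have "to_fract (reflect_poly p) = vv ^ degree (map_poly qv_of_rat p) * subst_inv p"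
    using poly_reflect_poly_nz[of vv "map_poly qv_of_rat p"] poly_qv_vv[of "reflect_poly p"]
    by (simp add: subst_inv_def)
  with A show "p = 0" by simp
qed simp

text \<open>The field automorphism \<open>v \<mapsto> v\<^sup>-\<^sup>1\<close>; independence of the chosen fraction is \<open>qbar_Fract\<close>.\<close>

definition qbar :: "qv \<Rightarrow> qv" where
  "qbar x = (THE y. \<exists>p q. q \<noteq> 0 \<and> x = Fract p q \<and> y = subst_inv p / subst_inv q)"

lemma qbar_Fract:
  assumes "q \<noteq> 0"
  shows "qbar (Fract p q) = subst_inv p / subst_inv q"
  unfolding qbar_def
proof (rule the_equality)
  fix y assume "\<exists>p' q'. q' \<noteq> 0 \<and> Fract p q = Fract p' q' \<and> y = subst_inv p' / subst_inv q'"
  then obtain p' q' where *: "q' \<noteq> 0" "Fract p q = Fract p' q'" "y = subst_inv p' / subst_inv q'"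
    by blast
  with assms have "p * q' = p' * q" by (simp add: eq_fract)
  then have "subst_inv p * subst_inv q' = subst_inv p' * subst_inv q"
    by (simp flip: subst_inv_mult)
  then show "y = subst_inv p / subst_inv q"
    using assms * by (simp add: frac_eq_eq)
qed (use assms in blast)

lemma subst_inv_1 [simp]: "subst_inv 1 = 1"
  using subst_inv_pCons[of 1 0] by (simp add: one_pCons flip: to_fract_1)

lemma qbar_0 [simp]: "qbar 0 = 0"
  using qbar_Fract[of 1 0] by (simp add: fract_collapse)

lemma qbar_1 [simp]: "qbar 1 = 1"
  using qbar_Fract[of 1 1] by (simp add: fract_collapse)

lemma qbar_add: "qbar (x + y) = qbar x + qbar y"
  by (cases x; cases y) (simp add: qbar_Fract subst_inv_add subst_inv_mult field_simps)

lemma qbar_mult: "qbar (x * y) = qbar x * qbar y"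
  by (cases x; cases y) (simp add: qbar_Fract subst_inv_mult)

lemma qbar_minus: "qbar (- x) = - qbar x"
  by (cases x) (simp add: qbar_Fract subst_inv_minus)

lemma qbar_diff: "qbar (x - y) = qbar x - qbar y"
  using qbar_add[of x "- y"] by (simp add: qbar_minus)

lemma qbar_inverse: "qbar (inverse x) = inverse (qbar x)"
proof (cases "x = 0")
  case False
  then have "qbar x * qbar (inverse x) = 1" by (simp flip: qbar_mult)
  then show ?thesis by (metis inverse_unique)
qed simp

lemma qbar_divide: "qbar (x / y) = qbar x / qbar y"
  by (simp add: divide_inverse qbar_mult qbar_inverse)

lemma qbar_power: "qbar (x ^ n) = qbar x ^ n"
  by (induction n) (simp_all add: qbar_mult)

lemma qbar_vv [simp]: "qbar vv = inverse vv"
proof -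
  have "qbar vv = qbar (Fract [:0, 1:] 1)" by (simp add: vv_def to_fract_def)
  moreover have "qv_of_rat 1 = 1" by (simp flip: one_pCons)
  ultimately show ?thesis by (simp add: qbar_Fract subst_inv_pCons)
qed

definition qint :: "nat \<Rightarrow> qv" where
  "qint m = (vv ^ m - inverse vv ^ m) / (vv - inverse vv)"

definition qfact :: "nat \<Rightarrow> qv" where
  "qfact m = (\<Prod>k=1..m. qint k)"

lemma qbar_qint [simp]: "qbar (qint m) = qint m"
proof -
  have "qbar (qint m) = (inverse vv ^ m - vv ^ m) / (inverse vv - vv)"
    by (simp add: qint_def qbar_divide qbar_diff qbar_power qbar_inverse)
  also have "\<dots> = (- (vv ^ m - inverse vv ^ m)) / (- (vv - inverse vv))" by simp
  also have "\<dots> = qint m" unfolding qint_def by (rule minus_divide_divide)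
  finally show ?thesis .
qed

lemma vv_sq_neq_1: "vv ^ 2 \<noteq> 1"
proof
  assume "vv ^ 2 = 1"
  then have "to_fract ([:0, 1:] ^ 2 :: rat poly) = to_fract 1"
    by (simp add: vv_def power2_eq_square flip: to_fract_mult)
  then show False by (simp only: to_fract_eq_iff) (simp add: power2_eq_square one_pCons)
qed

lemma qint_3: "qint 3 = vv ^ 2 + 1 + inverse vv ^ 2"
proof -
  have "vv - inverse vv \<noteq> 0"
    using vv_sq_neq_1 by (simp add: field_simps power2_eq_square)
  then show ?thesis
    by (simp add: qint_def divide_eq_eq) (simp add: algebra_simps power2_eq_square power3_eq_cube)
qed


section \<open>The free algebra on two generators\<close>

datatype node = N1 | N2

text \<open>The Cartan matrix of affine type \<open>A\<^sub>1\<close>; being symmetric, it is also the Cartan pairing.\<close>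

definition cart :: "node \<Rightarrow> node \<Rightarrow> int" where
  "cart i j = (if i = j then 2 else -2)"

lemma cart_commute: "cart i j = cart j i"
  by (simp add: cart_def)

instantiation list :: (type) monoid_add
begin

definition zero_list :: "'a list" where "zero_list = []"
definition plus_list :: "'a list \<Rightarrow> 'a list \<Rightarrow> 'a list" where "plus_list = (@)"

instance
  by standard (simp_all add: zero_list_def plus_list_def)

end

text \<open>Finitely supported functions on words with the convolution product, that is, the free
  associative \<open>\<rat>(v)\<close>-algebra on the nodes.\<close>

type_synonym falg = "node list \<Rightarrow>\<^sub>0 qv"

abbreviation scal :: "qv \<Rightarrow> falg" where
  "scal c \<equiv> Poly_Mapping.single 0 c"

abbreviation wd :: "node list \<Rightarrow> falg" where
  "wd w \<equiv> Poly_Mapping.single w 1"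

abbreviation gen :: "node \<Rightarrow> falg" where
  "gen i \<equiv> wd [i]"

text \<open>\<open>\<Sum>\<^sub>k (-1)\<^sup>k [3 choose k] E\<^sub>i\<^bsup>3-k\<^esup> E\<^sub>j E\<^sub>i\<^bsup>k\<^esup>\<close> with \<open>3 = 1 - a\<^bsub>ij\<^esub>\<close>; the quantum binomial
  coefficients \<open>[3 choose k]\<close> are \<open>1, [3], [3], 1\<close>.\<close>

definition serre :: "node \<Rightarrow> node \<Rightarrow> falg" where
  "serre i j = gen i ^ 3 * gen j - scal (qint 3) * gen i ^ 2 * gen j * gen i
     + scal (qint 3) * gen i * gen j * gen i ^ 2 - gen j * gen i ^ 3"

inductive_set serre_ideal :: "falg set" where
  zero: "0 \<in> serre_ideal"
| gen: "i \<noteq> j \<Longrightarrow> f * serre i j * g \<in> serre_ideal"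
| add: "f \<in> serre_ideal \<Longrightarrow> g \<in> serre_ideal \<Longrightarrow> f + g \<in> serre_ideal"

lemma falg_induct [case_names single add]:
  fixes f :: falg
  assumes "\<And>w c. P (Poly_Mapping.single w c)" "\<And>f g. P f \<Longrightarrow> P g \<Longrightarrow> P (f + g)"
  shows "P f"
proof (induction f rule: update_induct)
  case const
  show ?case using assms(1)[of 0 0] by simp
next
  case (update f a b)
  have "Poly_Mapping.update a b f = f + Poly_Mapping.single a b"
    using update(1)
    by (intro poly_mapping_eqI) (auto simp: lookup_update lookup_add lookup_single in_keys_iff when_def)
  then show ?case using assms update by simp
qed

lemma scal_commute: "scal c * f = f * scal c"
  by (induction f rule: falg_induct)
     (simp_all add: mult_single algebra_simps)

lemma serre_ideal_mult:
  assumes "f \<in> serre_ideal"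
  shows "g * f * h \<in> serre_ideal"
  using assms
proof induction
  case (gen i j a b)
  then have "(g * a) * serre i j * (b * h) \<in> serre_ideal" by (rule serre_ideal.gen)
  then show ?case by (simp add: mult.assoc)
qed (auto simp: distrib_left distrib_right intro: serre_ideal.intros)

lemma serre_ideal_minus: "f \<in> serre_ideal \<Longrightarrow> - f \<in> serre_ideal"
  using serre_ideal_mult[of f "-1" 1] by simp

lemma serre_ideal_diff:
  "f \<in> serre_ideal \<Longrightarrow> g \<in> serre_ideal \<Longrightarrow> f - g \<in> serre_ideal"
  using serre_ideal.add[of f "- g"] serre_ideal_minus by simp


section \<open>Lusztig's bilinear form\<close>

text \<open>
  \<open>lder i\<close> is the skew derivation \<open>\<^sub>ir\<close> with \<open>\<^sub>ir(\<theta>\<^sub>j) = \<delta>\<^bsub>ij\<^esub>\<close> and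
  \<open>\<^sub>ir(xy) = \<^sub>ir(x)y + v\<^bsup>(i,|x|)\<^esup> x \<^sub>ir(y)\<close>; it is the component of the twisted coproduct
  whose left factor has degree \<open>\<alpha>\<^sub>i\<close>.
\<close>

fun lder_word :: "node \<Rightarrow> node list \<Rightarrow> falg" where
  "lder_word i [] = 0"
| "lder_word i (j # w) =
     (if i = j then wd w else 0) + scal (vv powi cart i j) * gen j * lder_word i w"

definition lder :: "node \<Rightarrow> falg \<Rightarrow> falg" where
  "lder i f = (\<Sum>w\<in>Poly_Mapping.keys f. scal (Poly_Mapping.lookup f w) * lder_word i w)"

definition gen_norm :: qv where
  "gen_norm = 1 / (1 - inverse vv ^ 2)"

text \<open>
  The form is normalised by \<open>(1,1) = 1\<close> and \<open>(\<theta>\<^sub>i,\<theta>\<^sub>j) = \<delta>\<^bsub>ij\<^esub>/(1 - v\<^bsup>-2\<^esup>)\<close>. Compatibility with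
  the coproduct forces \<open>(\<theta>\<^sub>i x, y) = (\<theta>\<^sub>i,\<theta>\<^sub>i) (x, \<^sub>ir(y))\<close>, which is used as the recursion.
\<close>

fun form_word :: "node list \<Rightarrow> falg \<Rightarrow> qv" where
  "form_word [] g = Poly_Mapping.lookup g 0"
| "form_word (i # w) g = gen_norm * form_word w (lder i g)"

definition form_free :: "falg \<Rightarrow> falg \<Rightarrow> qv" where
  "form_free f g = (\<Sum>w\<in>Poly_Mapping.keys f. Poly_Mapping.lookup f w * form_word w g)"

lemma sum_keys_add:
  fixes f g :: falg and h :: "node list \<Rightarrow> qv \<Rightarrow> 'b::comm_monoid_add"
  assumes "\<And>w. h w 0 = 0" "\<And>w a b. h w (a + b) = h w a + h w b"
  shows "(\<Sum>w\<in>Poly_Mapping.keys (f + g). h w (Poly_Mapping.lookup (f + g) w)) =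
    (\<Sum>w\<in>Poly_Mapping.keys f. h w (Poly_Mapping.lookup f w)) +
    (\<Sum>w\<in>Poly_Mapping.keys g. h w (Poly_Mapping.lookup g w))"
proof -
  let ?K = "Poly_Mapping.keys f \<union> Poly_Mapping.keys g"
  have *: "(\<Sum>w\<in>Poly_Mapping.keys p. h w (Poly_Mapping.lookup p w)) =
      (\<Sum>w\<in>?K. h w (Poly_Mapping.lookup p w))" if "Poly_Mapping.keys p \<subseteq> ?K" for p :: falg
    using that by (intro sum.mono_neutral_left) (auto simp: in_keys_iff assms)
  show ?thesis
    unfolding *[OF keys_add[of f g]] *[OF Un_upper1] *[OF Un_upper2]
    by (simp add: lookup_add assms sum.distrib)
qed

lemma lder_single [simp]: "lder i (Poly_Mapping.single w c) = scal c * lder_word i w"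
  by (simp add: lder_def)

lemma lder_add: "lder i (f + g) = lder i f + lder i g"
  unfolding lder_def
  by (rule sum_keys_add) (simp_all add: single_add distrib_right)

lemma form_free_single [simp]: "form_free (Poly_Mapping.single w c) g = c * form_word w g"
  by (simp add: form_free_def)

lemma form_free_add_left: "form_free (f + f') g = form_free f g + form_free f' g"
  unfolding form_free_def
  by (rule sum_keys_add) (simp_all add: distrib_right)

lemma single_eq_scal_wd: "Poly_Mapping.single w c = scal c * wd w"
  by (simp add: mult_single)

lemma wd_Cons: "wd (j # w) = gen j * wd w"
  by (simp add: mult_single plus_list_def)

lemma wd_append: "wd (u @ w) = wd u * wd w"
  by (simp add: mult_single plus_list_def)

lemma wd_Nil: "wd [] = 1"
  by (simp flip: zero_list_def)

lemma scal_mult: "scal (a * b) = scal a * scal b"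
  by (simp add: mult_single)

lemma scal_left_commute: "f * (scal c * g) = scal c * (f * g)"
  by (simp only: mult.assoc[symmetric] scal_commute[of c f])

lemma lder_scal: "lder i (scal c * f) = scal c * lder i f"
proof (induction f rule: falg_induct)
  case (single w d)
  have "scal c * Poly_Mapping.single w d = Poly_Mapping.single w (c * d)"
    by (simp add: mult_single)
  then show ?case by (simp add: scal_mult mult.assoc)
qed (simp add: lder_add distrib_left)

lemma lder_gen_mult:
  "lder i (gen j * f) = (if i = j then f else 0) + scal (vv powi cart i j) * gen j * lder i f"
proof (induction f rule: falg_induct)
  case (single w c)
  have "lder i (gen j * Poly_Mapping.single w c) = scal c * lder_word i (j # w)"
    by (simp add: mult_single plus_list_def)
  also have "\<dots> = (if i = j then Poly_Mapping.single w c else 0)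
      + scal c * (scal (vv powi cart i j) * gen j * lder_word i w)"
    by (simp add: distrib_left mult_single)
  also have "scal c * (scal (vv powi cart i j) * gen j * lder_word i w) =
      scal (vv powi cart i j) * gen j * (scal c * lder_word i w)"
    by (rule scal_left_commute[symmetric])
  finally show ?case by simp
qed (simp add: lder_add distrib_left)

text \<open>\<open>lder_twist i\<close> multiplies the component of degree \<open>\<nu>\<close> by \<open>v\<^bsup>(i,\<nu>)\<^esup>\<close>.\<close>

definition twist_word :: "node \<Rightarrow> node list \<Rightarrow> qv" where
  "twist_word i w = prod_list (map (\<lambda>j. vv powi cart i j) w)"

definition lder_twist :: "node \<Rightarrow> falg \<Rightarrow> falg" where
  "lder_twist i f = (\<Sum>w\<in>Poly_Mapping.keys f.
     Poly_Mapping.single w (Poly_Mapping.lookup f w * twist_word i w))"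

lemma lder_twist_single [simp]:
  "lder_twist i (Poly_Mapping.single w c) = Poly_Mapping.single w (c * twist_word i w)"
  by (simp add: lder_twist_def)

lemma lder_twist_add: "lder_twist i (f + g) = lder_twist i f + lder_twist i g"
  unfolding lder_twist_def
  by (rule sum_keys_add) (simp_all add: distrib_right single_add)

lemma lder_wd_mult: "lder i (wd w * f) = lder_word i w * f + lder_twist i (wd w) * lder i f"
proof (induction w)
  case Nil
  have "lder_twist i (wd []) = 1"
    by (simp only: lder_twist_single) (simp add: twist_word_def, simp flip: zero_list_def)
  then show ?case by (simp add: wd_Nil)
next
  case (Cons j w)
  have tw: "lder_twist i (wd (j # w)) = scal (vv powi cart i j) * gen j * lder_twist i (wd w)"
    by (simp add: mult_single plus_list_def zero_list_def twist_word_def)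
  have "lder i (wd (j # w) * f) = lder i (gen j * (wd w * f))"
    by (simp only: wd_Cons[of j w] mult.assoc)
  also have "\<dots> = lder_word i (j # w) * f + lder_twist i (wd (j # w)) * lder i f"
    by (simp only: lder_gen_mult Cons tw) (simp add: distrib_left distrib_right mult.assoc)
  finally show ?case .
qed

lemma lder_mult: "lder i (f * g) = lder i f * g + lder_twist i f * lder i g"
proof (induction f rule: falg_induct)
  case (single w c)
  have "lder i (Poly_Mapping.single w c * g) = scal c * lder i (wd w * g)"
    by (simp only: single_eq_scal_wd[of w c] mult.assoc lder_scal)
  also have "\<dots> = scal c * (lder_word i w * g + lder_twist i (wd w) * lder i g)"
    by (simp only: lder_wd_mult)
  also have "\<dots> = (scal c * lder_word i w) * g + (scal c * lder_twist i (wd w)) * lder i g"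
    by (simp only: distrib_left mult.assoc)
  also have "scal c * lder_twist i (wd w) = lder_twist i (Poly_Mapping.single w c)"
    by (simp add: mult_single)
  finally show ?case by simp
qed (simp add: lder_add lder_twist_add distrib_right)

lemma lder_twist_mult: "lder_twist i (f * g) = lder_twist i f * lder_twist i g"
proof (induction f rule: falg_induct)
  case (single w c)
  show ?case
  proof (induction g rule: falg_induct)
    case (single u d)
    show ?case by (simp add: mult_single plus_list_def twist_word_def ac_simps)
  qed (simp add: lder_twist_add distrib_left)
qed (simp add: lder_twist_add distrib_right)

lemma serre_expand:
  "serre i j = wd [i,i,i,j] + Poly_Mapping.single [i,i,j,i] (- qint 3)
     + Poly_Mapping.single [i,j,i,i] (qint 3) + Poly_Mapping.single [j,i,i,i] (- 1)"
  by (simp add: serre_def power3_eq_cube power2_eq_square mult_single plus_list_def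
      zero_list_def single_uminus)

lemma lder_serre:
  assumes "i \<noteq> j"
  shows "lder k (serre i j) = 0"
proof -
  let ?s = "Poly_Mapping.single :: node list \<Rightarrow> qv \<Rightarrow> falg"
  define q where "q = inverse vv"
  have vq [simp]: "vv * q = 1" "vv * (q * x) = x" for x
    by (simp_all add: q_def)
  have c: "vv powi 2 = vv ^ 2" "vv powi - 2 = q ^ 2"
    by (simp_all add: q_def power_int_minus power_inverse)
  have ne: "j \<noteq> i" using assms by simp
  have k: "k = i \<or> k = j" using assms by (cases i; cases j; cases k) simp_all
  note simps = cart_def c ne assms mult_single plus_list_def zero_list_def distrib_left
  have 1: "lder_word i [i,i,i,j] = ?s [i,i,j] (1 + vv ^ 2 + vv ^ 2 * vv ^ 2)"
    by (simp add: simps single_add)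
  have 2: "lder_word i [i,i,j,i] = ?s [i,j,i] (1 + vv ^ 2) + ?s [i,i,j] (vv ^ 2 * vv ^ 2 * q ^ 2)"
    by (simp add: simps single_add mult.assoc)
  have 3: "lder_word i [i,j,i,i] = ?s [j,i,i] 1 + ?s [i,j,i] (vv ^ 2 * q ^ 2 + vv ^ 2 * q ^ 2 * vv ^ 2)"
    by (simp add: simps single_add mult.assoc)
  have 4: "lder_word i [j,i,i,i] = ?s [j,i,i] (q ^ 2 + q ^ 2 * vv ^ 2 + q ^ 2 * vv ^ 2 * vv ^ 2)"
    by (simp add: simps single_add mult.assoc)
  have 5: "lder_word j [i,i,i,j] = ?s [i,i,i] (q ^ 2 * q ^ 2 * q ^ 2)"
    "lder_word j [i,i,j,i] = ?s [i,i,i] (q ^ 2 * q ^ 2)"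
    "lder_word j [i,j,i,i] = ?s [i,i,i] (q ^ 2)"
    "lder_word j [j,i,i,i] = ?s [i,i,i] 1"
    by (simp_all add: simps mult.assoc)
  have q3: "qint 3 = vv ^ 2 + 1 + q ^ 2" by (simp add: qint_3 q_def)
  have vq2: "vv ^ 2 * q ^ 2 = 1" by (simp flip: power_mult_distrib)
  from k show ?thesis
  proof
    assume k: "k = i"
    have "lder k (serre i j) =
        ?s [i,i,j] ((1 + vv ^ 2 + vv ^ 2 * vv ^ 2) - qint 3 * (vv ^ 2 * (vv ^ 2 * q ^ 2)))
      + ?s [i,j,i] (qint 3 * (vv ^ 2 * q ^ 2 + vv ^ 2 * q ^ 2 * vv ^ 2) - qint 3 * (1 + vv ^ 2))
      + ?s [j,i,i] (qint 3 - (q ^ 2 + q ^ 2 * vv ^ 2 + q ^ 2 * vv ^ 2 * vv ^ 2))"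
      unfolding k serre_expand lder_add lder_single 1 2 3 4
      by (simp add: mult_single plus_list_def zero_list_def distrib_left single_diff single_uminus
          mult.assoc)
    also have "(1 + vv ^ 2 + vv ^ 2 * vv ^ 2) - qint 3 * (vv ^ 2 * (vv ^ 2 * q ^ 2)) = 0"
      using vq2 unfolding q3 by algebra
    also have "qint 3 * (vv ^ 2 * q ^ 2 + vv ^ 2 * q ^ 2 * vv ^ 2) - qint 3 * (1 + vv ^ 2) = 0"
      using vq2 by algebra
    also have "qint 3 - (q ^ 2 + q ^ 2 * vv ^ 2 + q ^ 2 * vv ^ 2 * vv ^ 2) = 0"
      using vq2 unfolding q3 by algebra
    finally show ?thesis by simp
  next
    assume k: "k = j"
    have "lder k (serre i j) =
        ?s [i,i,i] (q ^ 2 * q ^ 2 * q ^ 2 - qint 3 * (q ^ 2 * q ^ 2) + qint 3 * q ^ 2 - 1)"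
      unfolding k serre_expand lder_add lder_single 5
      by (simp add: mult_single plus_list_def zero_list_def single_add single_diff single_uminus)
    also have "q ^ 2 * q ^ 2 * q ^ 2 - qint 3 * (q ^ 2 * q ^ 2) + qint 3 * q ^ 2 - 1 = 0"
      using vq2 unfolding q3 by algebra
    finally show ?thesis by simp
  qed
qed

lemma lder_twist_serre:
  "lder_twist k (serre i j) = scal (twist_word k [i,i,i,j]) * serre i j"
  by (simp add: serre_expand lder_twist_add distrib_left mult_single twist_word_def plus_list_def
      zero_list_def ac_simps)

lemma lder_serre_ideal:
  assumes "f \<in> serre_ideal"
  shows "lder k f \<in> serre_ideal"
  using assms
proof induction
  case zero
  show ?case by (simp add: lder_def serre_ideal.zero)
next
  case (gen i j f g)
  have "lder k (f * serre i j * g) = lder k f * serre i j * g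
      + (lder_twist k f * scal (twist_word k [i,i,i,j])) * serre i j * lder k g"
    by (simp add: lder_mult lder_twist_mult lder_serre[OF gen] lder_twist_serre mult.assoc)
  then show ?case using gen by (auto intro: serre_ideal.add serre_ideal.gen)
next
  case (add f g)
  then show ?case by (simp add: lder_add serre_ideal.add)
qed

lemma lookup_0_mult: "Poly_Mapping.lookup (f * g) 0 = Poly_Mapping.lookup f 0 * Poly_Mapping.lookup g 0"
  for f g :: falg
proof (induction f rule: falg_induct)
  case (single w c)
  show ?case
  proof (induction g rule: falg_induct)
    case (single u d)
    show ?case by (simp add: mult_single lookup_single when_def plus_list_def zero_list_def)
  qed (simp add: distrib_left lookup_add)
qed (simp add: distrib_right lookup_add)

lemma lookup_0_serre_ideal: "f \<in> serre_ideal \<Longrightarrow> Poly_Mapping.lookup f 0 = 0"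
proof (induction rule: serre_ideal.induct)
  case (gen i j f g)
  have "Poly_Mapping.lookup (serre i j) 0 = 0"
    by (simp add: serre_expand lookup_add lookup_single when_def zero_list_def)
  then show ?case by (simp add: lookup_0_mult)
qed (simp_all add: lookup_add)

lemma form_word_serre_ideal: "g \<in> serre_ideal \<Longrightarrow> form_word w g = 0"
  by (induction w arbitrary: g) (simp_all add: lookup_0_serre_ideal lder_serre_ideal)

lemma form_word_add: "form_word w (f + g) = form_word w f + form_word w g"
  by (induction w arbitrary: f g) (simp_all add: lookup_add lder_add distrib_left)

lemma form_word_scal: "form_word w (scal c * g) = c * form_word w g"
  by (induction w arbitrary: g) (simp_all add: lookup_0_mult lder_scal)

lemma form_free_add_right: "form_free f (g + g') = form_free f g + form_free f g'"
  by (simp add: form_free_def form_word_add distrib_left sum.distrib)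

lemma form_free_scal_right: "form_free f (scal c * g) = c * form_free f g"
  by (simp add: form_free_def form_word_scal sum_distrib_left mult.left_commute)

lemma form_free_scal_left: "form_free (scal c * f) g = c * form_free f g"
  by (induction f rule: falg_induct)
     (simp_all add: mult_single form_free_add_left distrib_left)

lemma form_free_gen_left: "form_free (gen i * f) g = gen_norm * form_free f (lder i g)"
  by (induction f rule: falg_induct)
     (simp_all add: mult_single plus_list_def form_free_add_left distrib_left)

lemma form_word_gen: "form_word w (gen j * g) = gen_norm * form_free (lder j (wd w)) g"
proof (induction w arbitrary: g)
  case Nil
  have "form_word [] (gen j * g) = 0"
    by (simp add: lookup_0_mult) (simp add: lookup_single zero_list_def)
  then show ?case by (simp add: form_free_def)
next
  case (Cons i w)
  have "form_word (i # w) (gen j * g) = gen_norm * (if i = j then form_word w g else 0)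
      + gen_norm * (vv powi cart i j * (gen_norm * form_free (lder j (wd w)) (lder i g)))"
    using form_word_scal[of w 0 0]
    by (simp add: lder_gen_mult form_word_add form_word_scal Cons mult.assoc distrib_left)
  also have "\<dots> = gen_norm * form_free (lder j (wd (i # w))) g"
    by (simp add: form_free_add_left form_free_scal_left form_free_gen_left mult.assoc
        cart_commute[of j i] form_free_def[of 0] distrib_left)
  finally show ?case .
qed

lemma form_free_gen_right: "form_free f (gen j * g) = gen_norm * form_free (lder j f) g"
  by (induction f rule: falg_induct)
     (simp_all add: form_word_gen form_free_add_left form_free_scal_left lder_add distrib_left)

lemma form_free_wd_commute: "form_free f (wd w) = form_word w f"
proof (induction w arbitrary: f)
  case Nil
  have "form_free f 1 = Poly_Mapping.lookup f 0"
  proof (induction f rule: falg_induct)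
    case (single u c)
    have "form_word u 1 = (if u = [] then 1 else 0)"
    proof (cases u)
      case (Cons i u')
      have "lder i 1 = 0" using lder_single[of i "[]" 1] by (simp add: wd_Nil)
      then show ?thesis using Cons form_word_scal[of u' 0 0] by simp
    qed simp
    then show ?case by (simp add: lookup_single when_def zero_list_def)
  qed (simp add: form_free_add_left lookup_add)
  then show ?case by (simp add: wd_Nil)
next
  case (Cons i w)
  show ?case by (simp only: wd_Cons[of i w] form_free_gen_right Cons form_word.simps)
qed

lemma form_free_commute: "form_free f g = form_free g f"
proof (induction g rule: falg_induct)
  case (single w c)
  show ?case
    by (subst single_eq_scal_wd) (simp add: form_free_scal_right form_free_wd_commute)
qed (simp add: form_free_add_left form_free_add_right)

lemma form_free_serre_ideal: "g \<in> serre_ideal \<Longrightarrow> form_free f g = 0"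
  by (simp add: form_free_def form_word_serre_ideal)


section \<open>The bar involution on the free algebra\<close>

text \<open>Semilinear over \<open>v \<mapsto> v\<^sup>-\<^sup>1\<close> and fixing every word, hence a ring homomorphism
  (\<open>bar_free_mult\<close>).\<close>

definition bar_free :: "falg \<Rightarrow> falg" where
  "bar_free f = Poly_Mapping.map qbar f"

lemma lookup_bar_free: "Poly_Mapping.lookup (bar_free f) w = qbar (Poly_Mapping.lookup f w)"
  by (simp add: bar_free_def map.rep_eq when_def)

lemma bar_free_single [simp]: "bar_free (Poly_Mapping.single w c) = Poly_Mapping.single w (qbar c)"
  by (simp add: bar_free_def)

lemma bar_free_add: "bar_free (f + g) = bar_free f + bar_free g"
  by (rule poly_mapping_eqI) (simp add: lookup_bar_free lookup_add qbar_add)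

lemma bar_free_minus: "bar_free (- f) = - bar_free f"
  by (rule poly_mapping_eqI) (simp add: lookup_bar_free qbar_minus)

lemma bar_free_diff: "bar_free (f - g) = bar_free f - bar_free g"
  by (rule poly_mapping_eqI) (simp add: lookup_bar_free lookup_minus qbar_diff)

lemma bar_free_mult: "bar_free (f * g) = bar_free f * bar_free g"
proof (induction f rule: falg_induct)
  case (single w c)
  show ?case
  proof (induction g rule: falg_induct)
    case (single u d)
    show ?case by (simp add: mult_single qbar_mult)
  qed (simp add: bar_free_add distrib_left)
qed (simp add: bar_free_add distrib_right)

lemma bar_free_serre: "bar_free (serre i j) = serre i j"
  by (simp add: serre_expand bar_free_add qbar_minus)

lemma bar_free_serre_ideal: "f \<in> serre_ideal \<Longrightarrow> bar_free f \<in> serre_ideal"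
proof (induction rule: serre_ideal.induct)
  case zero
  show ?case using bar_free_diff[of 0 0] by (simp add: serre_ideal.zero)
qed (simp_all add: bar_free_mult bar_free_serre bar_free_add serre_ideal.gen serre_ideal.add)


section \<open>The algebra \<open>U\<^sub>v\<^sup>+\<close>\<close>

definition serre_cong :: "falg \<Rightarrow> falg \<Rightarrow> bool" where
  "serre_cong f g \<longleftrightarrow> f - g \<in> serre_ideal"

lemma equivp_serre_cong: "equivp serre_cong"
proof (rule equivpI)
  show "reflp serre_cong" by (simp add: reflp_def serre_cong_def serre_ideal.zero)
  show "symp serre_cong"
  proof (rule sympI)
    fix f g assume "serre_cong f g"
    then show "serre_cong g f"
      unfolding serre_cong_def using serre_ideal_minus[of "f - g"] by simp
  qed
  show "transp serre_cong"
  proof (rule transpI)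
    fix f g h assume "serre_cong f g" "serre_cong g h"
    then show "serre_cong f h"
      unfolding serre_cong_def using serre_ideal.add[of "f - g" "g - h"] by simp
  qed
qed

quotient_type uplus = falg / serre_cong
  by (rule equivp_serre_cong)

instantiation uplus :: ring_1
begin

lift_definition zero_uplus :: uplus is 0 .
lift_definition one_uplus :: uplus is 1 .

lift_definition plus_uplus :: "uplus \<Rightarrow> uplus \<Rightarrow> uplus" is "(+)"
  unfolding serre_cong_def by (drule (1) serre_ideal.add) (simp add: algebra_simps)

lift_definition uminus_uplus :: "uplus \<Rightarrow> uplus" is uminus
  unfolding serre_cong_def by (drule serre_ideal_minus) (simp add: algebra_simps)

lift_definition minus_uplus :: "uplus \<Rightarrow> uplus \<Rightarrow> uplus" is "(-)"
  unfolding serre_cong_def by (drule (1) serre_ideal_diff) (simp add: algebra_simps)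

lift_definition times_uplus :: "uplus \<Rightarrow> uplus \<Rightarrow> uplus" is "(*)"
proof -
  fix f f' g g' assume "serre_cong f f'" "serre_cong g g'"
  then have "1 * (f - f') * g + f' * (g - g') * 1 \<in> serre_ideal"
    unfolding serre_cong_def by (intro serre_ideal.add serre_ideal_mult)
  then show "serre_cong (f * g) (f' * g')"
    by (simp add: serre_cong_def algebra_simps)
qed

instance
proof
  have refl: "serre_cong f f" for f
    by (simp add: serre_cong_def serre_ideal.zero)
  fix x y z :: uplus
  show "x + y + z = x + (y + z)" by transfer (simp only: add.assoc refl)
  show "x + y = y + x" by transfer (simp add: add.commute refl)
  show "0 + x = x" by transfer (simp add: refl)
  show "- x + x = 0" by transfer (simp add: refl)
  show "x - y = x + - y" by transfer (simp add: refl)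
  show "x * y * z = x * (y * z)" by transfer (simp only: mult.assoc refl)
  show "1 * x = x" by transfer (simp add: refl)
  show "x * 1 = x" by transfer (simp add: refl)
  show "(x + y) * z = x * z + y * z" by transfer (simp only: distrib_right refl)
  show "x * (y + z) = x * y + x * z" by transfer (simp only: distrib_left refl)
  show "(0::uplus) \<noteq> 1"
  proof (transfer, rule notI)
    assume "serre_cong 0 1"
    then have "Poly_Mapping.lookup (0 - 1 :: falg) 0 = 0"
      unfolding serre_cong_def by (rule lookup_0_serre_ideal)
    then show False
      unfolding lookup_minus lookup_zero lookup_one_zero by simp
  qed
qed

end

lift_definition U_scal :: "qv \<Rightarrow> uplus" is scal .

lift_definition U_gen :: "node \<Rightarrow> uplus" is gen .

lift_definition U_bar :: "uplus \<Rightarrow> uplus" is bar_free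
  unfolding serre_cong_def by (drule bar_free_serre_ideal) (simp add: bar_free_diff)

lift_definition U_form :: "uplus \<Rightarrow> uplus \<Rightarrow> qv" is form_free
proof -
  have *: "form_free f g = form_free f g'" if "serre_cong g g'" for f g g'
    using form_free_add_right[of f "g - g'" g'] form_free_serre_ideal[of "g - g'" f] that
    by (simp add: serre_cong_def)
  fix f f' g g' assume "serre_cong f f'" "serre_cong g g'"
  then have "form_free f g = form_free f g'" "form_free g' f = form_free g' f'"
    by (auto intro: *)
  then show "form_free f g = form_free f' g'"
    by (simp add: form_free_commute[of f g'] form_free_commute[of f' g'])
qed

definition divpow :: "node \<Rightarrow> nat \<Rightarrow> uplus" where
  "divpow i m = U_scal (1 / qfact m) * U_gen i ^ m"

definition monomial :: "(node \<times> nat) list \<Rightarrow> uplus" where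
  "monomial ms = prod_list (map (\<lambda>(i, m). divpow i m) ms)"


section \<open>The canonical basis\<close>

definition zlaurent :: "qv set" where
  "zlaurent = {to_fract (map_poly of_int p) / vv ^ n | (p :: int poly) n. True}"

text \<open>The integral form: the \<open>\<int>[v,v\<^sup>-\<^sup>1]\<close>-subalgebra generated by all divided powers.\<close>

inductive_set U_int :: "uplus set" where
  scal: "c \<in> zlaurent \<Longrightarrow> U_scal c \<in> U_int"
| divpow: "divpow i m \<in> U_int"
| add: "x \<in> U_int \<Longrightarrow> y \<in> U_int \<Longrightarrow> x + y \<in> U_int"
| mult: "x \<in> U_int \<Longrightarrow> y \<in> U_int \<Longrightarrow> x * y \<in> U_int"

text \<open>The ring \<open>\<rat>(v) \<inter> \<rat>[[v\<^sup>-\<^sup>1]]\<close> of rational functions regular at \<open>v = \<infinity>\<close>.\<close>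

definition reg_inf :: "qv set" where
  "reg_inf = {to_fract p / to_fract q | p q. q \<noteq> 0 \<and> degree p \<le> degree q}"

text \<open>
  Lusztig's canonical signed basis: the integral bar-invariant elements \<open>x\<close> with
  \<open>(x,x) \<in> 1 + v\<^sup>-\<^sup>1 (\<rat>(v) \<inter> \<rat>[[v\<^sup>-\<^sup>1]])\<close>. It consists of the canonical basis elements and
  their negatives.
\<close>

definition signed_basis :: "uplus set" where
  "signed_basis =
     {x \<in> U_int. U_bar x = x \<and> (\<exists>a\<in>reg_inf. U_form x x = 1 + inverse vv * a)}"

definition signed_basis_at :: "node \<Rightarrow> nat \<Rightarrow> uplus set" where
  "signed_basis_at i n =
     {x \<in> signed_basis. x \<in> range ((*) (U_gen i ^ n)) \<and> x \<notin> range ((*) (U_gen i ^ Suc n))}"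

text \<open>
  The graph of Lusztig's bijection \<open>\<pi>\<^bsub>i,n\<^esub>\<close> from \<open>signed_basis_at i 0\<close> to \<open>signed_basis_at i n\<close>:
  \<open>x\<close> is sent to the unique \<open>y\<close> with \<open>E\<^sub>i\<^bsup>(n)\<^esup> x \<equiv> y\<close> modulo \<open>E\<^sub>i\<^bsup>n+1\<^esup> U\<^sup>+\<close>.
\<close>

definition lusztig_pi :: "node \<Rightarrow> nat \<Rightarrow> uplus \<Rightarrow> uplus \<Rightarrow> bool" where
  "lusztig_pi i n x y \<longleftrightarrow> x \<in> signed_basis_at i 0 \<and> y \<in> signed_basis_at i n \<and>
     divpow i n * x - y \<in> range ((*) (U_gen i ^ Suc n))"

text \<open>The signs are fixed by starting from \<open>1\<close> and transporting along the maps \<open>\<pi>\<^bsub>i,n\<^esub>\<close>.\<close>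

inductive_set canonical_basis :: "uplus set" where
  one: "1 \<in> canonical_basis"
| step: "x \<in> canonical_basis \<Longrightarrow> n > 0 \<Longrightarrow> lusztig_pi i n x y \<Longrightarrow> y \<in> canonical_basis"

definition tight :: "(node \<times> nat) list \<Rightarrow> bool" where
  "tight ms \<longleftrightarrow> monomial ms \<in> canonical_basis"

end

theory Submission
  imports Defs
begin

text \<open>
  Write \<open>M = E\<^sub>i\<^bsup>(a)\<^esup> E\<^sub>j\<^bsup>(b)\<^esup> E\<^sub>i\<^bsup>(c)\<^esup>\<close> with \<open>i \<noteq> j\<close>. It is integral and bar invariant, so it lies in the canonical
  basis up to sign exactly when \<open>(M, M) \<in> 1 + v\<^sup>-\<^sup>1 A\<close>, where \<open>A\<close> is the ring of rational functions
  regular at \<open>v = \<infinity>\<close>. Everything therefore turns on the size of \<open>(M, M)\<close> at infinity.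

  The skew derivation \<open>\<^sub>ir\<close> sends \<open>E\<^sub>i\<^bsup>(m)\<^esup> E\<^sub>j\<^bsup>(b)\<^esup> E\<^sub>i\<^bsup>(n)\<^esup>\<close> to a combination of the two monomials in which \<open>m\<close>
  or \<open>n\<close> has dropped by one, and it is adjoint to left multiplication by \<open>E\<^sub>i\<close>. This gives a
  recursion for all values of the form on such monomials. After division by the expected power of
  \<open>v\<close>, it becomes a recursion with positive coefficients (\<open>overlap_Suc_Suc\<close>): a factor in
  \<open>1 + v\<^sup>-\<^sup>1 A\<close> times a sum of two earlier values, the second weighted by \<open>v\<^bsup>2(m+k+1-2b)\<^esup>\<close>. As long as
  \<open>a + c \<le> 2b\<close>, every weight that occurs is a negative power of \<open>v\<close> and \<open>(M, M) \<in> 1 + v\<^sup>-\<^sup>1 A\<close>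
  (\<open>near_one_overlap\<close>).

  If \<open>a + c > 2b\<close>, the weight in the last step is at least \<open>1\<close>. In the ordering of \<open>\<rat>(v)\<close> by the
  behaviour of functions as \<open>v \<rightarrow> \<infinity>\<close> all values are at least \<open>1\<close>, so \<open>(M, M) \<ge> 2\<close>
  (\<open>overlap_ge_2\<close>), whereas elements of \<open>1 + v\<^sup>-\<^sup>1 A\<close> are less than \<open>2\<close>. Hence \<open>M\<close> is not even a
  signed basis element.

  For the sign when \<open>a + c \<le> 2b\<close>, \<open>M\<close> is reached from \<open>1\<close> by Lusztig's bijections, through
  \<open>E\<^sub>i\<^bsup>(c)\<^esup>\<close> and \<open>E\<^sub>j\<^bsup>(b)\<^esup> E\<^sub>i\<^bsup>(c)\<^esup>\<close>. Each step needs that the monomial is not divisible on the left by a higher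
  power of the generator than it visibly is. Since \<open>E\<^sub>i U\<close> is orthogonal to the kernel of \<open>\<^sub>ir\<close>, it is
  enough to pair with a vector of that kernel; for \<open>E\<^sub>j\<^bsup>(b)\<^esup> E\<^sub>i\<^bsup>(c)\<^esup>\<close> the vector is \<open>ker_vec\<close>, and the pairing
  lies in \<open>1 + v\<^sup>-\<^sup>1 A\<close> because \<open>c \<le> 2b\<close>.
\<close>

section \<open>Rational functions near \<open>v = \<infinity>\<close>\<close>

text \<open>
  The set \<open>1 + v\<^sup>-\<^sup>1 A\<close> is the condition on \<open>(x, x)\<close> in the definition of the signed basis. It is a
  multiplicative group, and it absorbs summands from \<open>v\<^sup>-\<^sup>1 A\<close>.
\<close>

definition near_one :: "qv \<Rightarrow> bool" where
  "near_one x \<longleftrightarrow> (\<exists>a\<in>reg_inf. x = 1 + inverse vv * a)"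

lemma reg_infI: "q \<noteq> 0 \<Longrightarrow> degree p \<le> degree q \<Longrightarrow> to_fract p / to_fract q \<in> reg_inf"
  unfolding reg_inf_def by blast

lemma reg_infE:
  assumes "x \<in> reg_inf"
  obtains p q where "x = to_fract p / to_fract q" "q \<noteq> 0" "degree p \<le> degree q"
  using assms unfolding reg_inf_def by blast

lemma reg_inf_0 [simp]: "0 \<in> reg_inf" and reg_inf_1 [simp]: "1 \<in> reg_inf"
  using reg_infI[of 1 0] reg_infI[of 1 1] by simp_all

lemma reg_inf_inverse_vv [simp]: "inverse vv \<in> reg_inf"
  using reg_infI[of "[:0, 1:]" 1] by (simp add: vv_def divide_inverse)

lemma reg_inf_minus: "x \<in> reg_inf \<Longrightarrow> - x \<in> reg_inf"
  by (elim reg_infE) (metis reg_infI degree_minus minus_divide_left to_fract_uminus)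

lemma reg_inf_mult:
  assumes "x \<in> reg_inf" "y \<in> reg_inf"
  shows "x * y \<in> reg_inf"
proof -
  from assms obtain p q p' q' where
    x: "x = to_fract p / to_fract q" "q \<noteq> 0" "degree p \<le> degree q" and
    y: "y = to_fract p' / to_fract q'" "q' \<noteq> 0" "degree p' \<le> degree q'"
    by (elim reg_infE)
  have "degree (p * p') \<le> degree (q * q')"
    using degree_mult_le[of p p'] x y by (simp add: degree_mult_eq)
  then show ?thesis using reg_infI[of "q * q'" "p * p'"] x y by simp
qed

lemma reg_inf_add:
  assumes "x \<in> reg_inf" "y \<in> reg_inf"
  shows "x + y \<in> reg_inf"
proof -
  from assms obtain p q p' q' where
    x: "x = to_fract p / to_fract q" "q \<noteq> 0" "degree p \<le> degree q" and
    y: "y = to_fract p' / to_fract q'" "q' \<noteq> 0" "degree p' \<le> degree q'"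
    by (elim reg_infE)
  have "degree (p * q' + p' * q) \<le> degree (q * q')"
    using degree_mult_le[of p q'] degree_mult_le[of p' q] x y
    by (intro degree_add_le) (simp_all add: degree_mult_eq)
  then show ?thesis using reg_infI[of "q * q'" "p * q' + p' * q"] x y by (simp add: add_frac_eq)
qed

lemma reg_inf_power: "x \<in> reg_inf \<Longrightarrow> x ^ n \<in> reg_inf"
  by (induction n) (simp_all add: reg_inf_mult)

lemma near_one_1 [simp]: "near_one 1"
  unfolding near_one_def by (rule bexI[of _ 0]) simp_all

lemma near_one_reg_inf: "near_one x \<Longrightarrow> x \<in> reg_inf"
  by (auto simp: near_one_def intro!: reg_inf_add reg_inf_mult)

lemma near_one_add:
  assumes "near_one x" "y \<in> reg_inf"
  shows "near_one (x + inverse vv * y)"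
proof -
  from assms obtain a where "a \<in> reg_inf" "x = 1 + inverse vv * a" by (auto simp: near_one_def)
  then show ?thesis
    using assms unfolding near_one_def
    by (intro bexI[of _ "a + y"]) (simp_all add: algebra_simps reg_inf_add)
qed

lemma near_one_mult:
  assumes "near_one x" "near_one y"
  shows "near_one (x * y)"
proof -
  from assms obtain a where a: "a \<in> reg_inf" "x = 1 + inverse vv * a" by (auto simp: near_one_def)
  then have "near_one (y + inverse vv * (a * y))"
    using assms by (intro near_one_add reg_inf_mult near_one_reg_inf[of y])
  then show ?thesis by (simp add: a algebra_simps)
qed

text \<open>
  Adding \<open>v\<^sup>-\<^sup>1 p/q\<close> to \<open>1\<close> puts \<open>v q + p\<close> over \<open>v q\<close>, and \<open>p\<close> is too small to affect the
  degree of the numerator. So such an element is nonzero and its inverse is again regular at infinity.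
\<close>

lemma near_oneE:
  assumes "near_one x"
  obtains d q where "x = to_fract d / (vv * to_fract q)" "q \<noteq> 0" "degree d = Suc (degree q)"
proof -
  from assms obtain p q where pq: "x = 1 + inverse vv * (to_fract p / to_fract q)"
      "q \<noteq> 0" "degree p \<le> degree q"
    by (auto simp: near_one_def elim!: reg_infE)
  have "degree (pCons 0 q + p) = Suc (degree q)"
    using pq by (subst degree_add_eq_left) simp_all
  moreover have "to_fract (pCons 0 q) = vv * to_fract q"
    unfolding vv_def to_fract_mult[symmetric] by simp
  then have "x = to_fract (pCons 0 q + p) / (vv * to_fract q)"
    using pq by (simp add: field_simps)
  ultimately show ?thesis using that pq by blast
qed

lemma near_one_nonzero: "near_one x \<Longrightarrow> x \<noteq> 0"
  by (erule near_oneE) auto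

lemma near_one_inverse:
  assumes "near_one x"
  shows "near_one (inverse x)"
proof -
  from assms obtain d q where x: "x = to_fract d / (vv * to_fract q)" "q \<noteq> 0"
      "degree d = Suc (degree q)"
    by (rule near_oneE)
  have "to_fract (pCons 0 q) = vv * to_fract q"
    unfolding vv_def to_fract_mult[symmetric] by simp
  then have "inverse x = to_fract (pCons 0 q) / to_fract d"
    using x by simp
  then have inv: "inverse x \<in> reg_inf"
    using x by (auto intro!: reg_infI)
  from assms obtain a where a: "a \<in> reg_inf" "x = 1 + inverse vv * a" by (auto simp: near_one_def)
  have "near_one (1 + inverse vv * (- (a * inverse x)))"
    using a inv by (intro near_one_add reg_inf_minus reg_inf_mult near_one_1)
  moreover have "1 + inverse vv * (- (a * inverse x)) = (x - inverse vv * a) * inverse x"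
    using near_one_nonzero[OF assms] by (simp add: algebra_simps)
  ultimately show ?thesis using a(2) by simp
qed

text \<open>
  The order on \<open>\<rat>(v)\<close> is the one induced by the sign of leading coefficients, that is, by
  the behaviour of functions for large \<open>v\<close>. Being regular at infinity means being bounded there,
  while \<open>v\<close> is unbounded.
\<close>

lemma reg_inf_less_vv:
  assumes "a \<in> reg_inf"
  shows "a < vv"
proof -
  from assms obtain p q where pq: "a = to_fract p / to_fract q" "q \<noteq> 0" "degree p \<le> degree q"
    by (elim reg_infE)
  let ?d = "pCons 0 (q * q) - p * q"
  have lt: "degree (p * q) < degree (pCons 0 (q * q))"
    using degree_mult_le[of p q] pq by (simp add: degree_mult_eq)
  \<comment> \<open>The sign of \<open>v - p/q\<close> is the sign of \<open>v q\<^sup>2 - p q\<close>, whose leading term is that of \<open>v q\<^sup>2\<close>.\<close>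
  then have "degree ?d = Suc (degree (q * q))" and "coeff (p * q) (Suc (degree (q * q))) = 0"
    using pq degree_add_eq_left[of "- (p * q)" "pCons 0 (q * q)"] by (simp_all add: coeff_eq_0)
  then have "coeff ?d (degree ?d) = lead_coeff q * lead_coeff q"
    by (simp add: lead_coeff_mult)
  then have "pos_poly ?d"
    using pq by (simp only: pos_poly_def) (simp add: zero_less_mult_iff flip: linorder_neq_iff)
  then have "Fract p q < Fract [:0, 1:] 1"
    using pq by (simp add: less_poly_def)
  then show ?thesis using pq by (simp add: Fract_conv_to_fract vv_def)
qed

lemma vv_gt_1: "1 < vv"
  by (rule reg_inf_less_vv) simp

lemma near_one_less_2:
  assumes "near_one x"
  shows "x < 2"
proof -
  from assms obtain a where "a \<in> reg_inf" "x = 1 + inverse vv * a" by (auto simp: near_one_def)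
  moreover have "inverse vv * a < 1"
    using reg_inf_less_vv[OF \<open>a \<in> reg_inf\<close>] vv_gt_1 by (simp add: field_simps)
  ultimately show ?thesis by simp
qed

lemma vv_powi_mult: "vv powi m * vv powi n = vv powi (m + n)"
  by (simp add: power_int_add)

lemma vv_power: "vv ^ n = vv powi int n" and inverse_vv_power: "inverse vv ^ n = vv powi (- int n)"
  by (simp_all add: power_int_minus power_inverse)

text \<open>
  This is the ratio \<open>(E\<^bsup>(k)\<^esup>, E\<^bsup>(k)\<^esup>) / (E\<^bsup>(k-1)\<^esup>, E\<^bsup>(k-1)\<^esup>)\<close>, a geometric series in \<open>v\<^bsup>-2k\<^esup>\<close>.
\<close>

definition geo :: "nat \<Rightarrow> qv" where
  "geo k = 1 / (1 - inverse vv ^ (2 * k))"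

lemma vv_powi_reg_inf: "n < 0 \<Longrightarrow> \<exists>y\<in>reg_inf. vv powi n = inverse vv * y"
  by (intro bexI[of _ "inverse vv ^ (nat (- n) - 1)"])
    (auto simp: reg_inf_power power_int_def simp flip: power_Suc)

lemma near_one_add_powi:
  assumes "near_one x" "near_one y" "n < 0"
  shows "near_one (x + vv powi n * y)"
proof -
  obtain z where "z \<in> reg_inf" "vv powi n = inverse vv * z" using vv_powi_reg_inf assms by blast
  then show ?thesis
    using near_one_add[of x "z * y"] assms by (simp add: reg_inf_mult near_one_reg_inf mult.assoc)
qed

lemma near_one_geo:
  assumes "k > 0"
  shows "near_one (geo k)"
proof -
  have "near_one (1 + inverse vv * (- (inverse vv ^ (2 * k - 1))))"
    by (intro near_one_add reg_inf_minus reg_inf_power) simp_all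
  also have "inverse vv * (- (inverse vv ^ (2 * k - 1))) = - (inverse vv ^ (2 * k))"
    using assms by (simp flip: power_Suc)
  finally show ?thesis
    unfolding geo_def using near_one_inverse by (simp add: divide_inverse)
qed

lemma geo_ge_1:
  assumes "k > 0"
  shows "1 \<le> geo k"
proof -
  have "inverse vv ^ (2 * k) < 1"
    using vv_gt_1 assms by (intro power_less_one_iff[THEN iffD2]) (auto simp: field_simps)
  moreover have "0 \<le> inverse vv ^ (2 * k)" using vv_gt_1 by simp
  ultimately show ?thesis by (simp add: geo_def)
qed

text \<open>
  Moving one generator out of \<open>E\<^sub>i\<^bsup>(n+1)\<^esup>\<close> across the form costs \<open>gen_norm / [n+1]\<close>. Splitting off the
  power of \<open>v\<close> leaves a factor that is both near one and at least one.
\<close>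

lemma gen_norm_divide_qint: "gen_norm / qint (Suc n) = inverse vv ^ n * geo (Suc n)"
proof -
  define w where "w = vv - inverse vv"
  define D where "D = 1 - inverse vv ^ (2 * Suc n)"
  have w: "w \<noteq> 0"
    using vv_sq_neq_1 by (simp add: w_def field_simps power2_eq_square)
  have "1 - inverse vv ^ 2 = w * inverse vv"
    by (simp add: w_def algebra_simps power2_eq_square)
  then have gn: "gen_norm = vv / w" by (simp add: gen_norm_def divide_inverse)
  have "vv ^ Suc n - inverse vv ^ Suc n = vv ^ Suc n * (1 - inverse vv ^ (2 * Suc n))"
    by (simp only: right_diff_distrib mult_2 power_add mult_1_right mult.assoc[symmetric]
        power_mult_distrib[symmetric]) simp
  then have "qint (Suc n) = vv ^ Suc n * D / w"
    by (simp only: qint_def w_def D_def)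
  then show ?thesis
    unfolding gn geo_def D_def[symmetric] using w by (simp add: power_inverse field_simps)
qed

lemma qint_nonzero: "qint (Suc n) \<noteq> 0"
proof
  assume "qint (Suc n) = 0"
  then have "inverse vv ^ n * geo (Suc n) = 0"
    unfolding gen_norm_divide_qint[symmetric] by simp
  then show False using geo_ge_1[of "Suc n"] by simp
qed

lemma qint_1 [simp]: "qint (Suc 0) = 1"
proof -
  have "vv - inverse vv \<noteq> 0"
    using vv_sq_neq_1 by (simp add: field_simps power2_eq_square)
  then show ?thesis by (simp add: qint_def)
qed

lemma qint_Suc: "vv ^ n * qint (Suc n) = 1 + vv ^ Suc n * qint n"
proof -
  have "vv - inverse vv \<noteq> 0"
    using vv_sq_neq_1 by (simp add: field_simps power2_eq_square)
  then show ?thesis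
    by (simp add: qint_def field_simps)
qed

section \<open>Calculus in \<open>U\<^sub>v\<^sup>+\<close>\<close>

text \<open>
  The skew derivation descends to the quotient because it annihilates the Serre elements and hence
  preserves the ideal they generate.
\<close>

lift_definition U_lder :: "node \<Rightarrow> uplus \<Rightarrow> uplus" is lder
proof -
  fix i f g assume "serre_cong f g"
  then show "serre_cong (lder i f) (lder i g)"
    unfolding serre_cong_def using lder_serre_ideal[of "f - g" i] lder_add[of i "f - g" g] by simp
qed

lemma U_eqI: "f = g \<Longrightarrow> serre_cong f g"
  by (simp add: serre_cong_def serre_ideal.zero)

lemma U_scal_mult: "U_scal (c * d) = U_scal c * U_scal d"
  by transfer (simp add: mult_single U_eqI)

lemma U_scal_add: "U_scal (c + d) = U_scal c + U_scal d"
  by transfer (simp add: single_add U_eqI)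

lemma U_scal_0 [simp]: "U_scal 0 = 0"
  by transfer (simp add: U_eqI)

lemma U_scal_1 [simp]: "U_scal 1 = 1"
  by transfer (simp add: U_eqI)

lemma U_scal_scal: "U_scal c * (U_scal d * x) = U_scal (c * d) * x"
  by (simp add: U_scal_mult mult.assoc)

lemma U_scal_left_commute: "x * (U_scal c * y) = U_scal c * (x * y)"
  by transfer (simp only: scal_left_commute U_eqI)

lemma U_lder_add: "U_lder i (x + y) = U_lder i x + U_lder i y"
  by transfer (simp only: lder_add U_eqI)

lemma U_lder_scal: "U_lder i (U_scal c * x) = U_scal c * U_lder i x"
  by transfer (simp only: lder_scal U_eqI)

lemma U_lder_0 [simp]: "U_lder i 0 = 0"
  using U_lder_scal[of i 0 0] by simp

lemma U_lder_1 [simp]: "U_lder i 1 = 0"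
proof (transfer, rule U_eqI)
  show "lder i 1 = 0" for i
    using lder_single[of i "[]" 1] by (simp add: wd_Nil)
qed

lemma U_lder_gen_mult:
  "U_lder i (U_gen j * x) =
     (if i = j then x else 0) + U_scal (vv powi cart i j) * (U_gen j * U_lder i x)"
  by transfer (simp only: lder_gen_mult mult.assoc U_eqI)

lemma U_form_add_right: "U_form z (x + y) = U_form z x + U_form z y"
  by transfer (rule form_free_add_right)

lemma U_form_scal_left: "U_form (U_scal c * x) y = c * U_form x y"
  by transfer (rule form_free_scal_left)

lemma U_form_scal_right: "U_form x (U_scal c * y) = c * U_form x y"
  by transfer (rule form_free_scal_right)

lemma U_form_0_right [simp]: "U_form x 0 = 0"
  using U_form_scal_right[of x 0 0] by simp

lemma U_form_sum_right: "U_form x (sum f A) = (\<Sum>k\<in>A. U_form x (f k))"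
  by (induction A rule: infinite_finite_induct) (simp_all add: U_form_add_right)

lemma U_lder_sum: "U_lder i (sum f A) = (\<Sum>k\<in>A. U_lder i (f k))"
  by (induction A rule: infinite_finite_induct) (simp_all add: U_lder_add)

lemma U_form_commute: "U_form x y = U_form y x"
  by transfer (rule form_free_commute)

lemma U_form_gen_left: "U_form (U_gen i * x) y = gen_norm * U_form x (U_lder i y)"
  by transfer (rule form_free_gen_left)

lemma U_form_1 [simp]: "U_form 1 1 = 1"
proof -
  have "form_free 1 (1 :: falg) = form_free (wd []) 1" by (simp only: wd_Nil)
  then have "form_free 1 1 = 1" by simp
  then show ?thesis by (simp add: one_uplus.abs_eq U_form.abs_eq)
qed

lemma U_bar_mult: "U_bar (x * y) = U_bar x * U_bar y"
  by transfer (simp only: bar_free_mult U_eqI)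

lemma U_bar_1 [simp]: "U_bar 1 = 1"
proof (transfer, rule U_eqI)
  show "bar_free 1 = 1"
    using bar_free_single[of 0 1] by simp
qed

lemma U_bar_scal: "U_bar (U_scal c) = U_scal (qbar c)"
  by transfer (simp add: U_eqI)

lemma U_bar_gen: "U_bar (U_gen i) = U_gen i"
  by transfer (simp add: U_eqI)

section \<open>Divided powers\<close>

lemma divpow_0 [simp]: "divpow i 0 = 1"
  by (simp add: divpow_def qfact_def)

lemma divpow_Suc: "divpow i (Suc n) = U_scal (1 / qint (Suc n)) * (U_gen i * divpow i n)"
  by (simp add: divpow_def qfact_def U_scal_left_commute[of "U_gen i"] U_scal_scal mult.commute)

lemma gen_mult_divpow: "U_gen i * divpow i n = U_scal (qint (Suc n)) * divpow i (Suc n)"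
  by (simp add: divpow_Suc U_scal_scal qint_nonzero)

lemma U_bar_divpow: "U_bar (divpow i n) = divpow i n"
  by (induction n) (simp_all add: divpow_Suc U_bar_mult U_bar_scal U_bar_gen qbar_divide)

text \<open>
  By induction, the two contributions to the coefficient of \<open>E\<^sub>i\<^bsup>(n)\<^esup> x\<close> combine through
  \<open>1 + v\<^bsup>n+1\<^esup> [n] = v\<^bsup>n\<^esup> [n+1]\<close>.
\<close>

lemma U_lder_divpow_same:
  "U_lder i (divpow i (Suc n) * x) = U_scal (vv ^ n) * (divpow i n * x)
     + U_scal (vv ^ (2 * Suc n)) * (divpow i (Suc n) * U_lder i x)"
proof (induction n)
  case 0
  show ?case
    by (simp add: divpow_Suc U_lder_gen_mult cart_def)
next
  case (Suc n)
  let ?q = "qint (Suc (Suc n))"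
  have e: "divpow i (Suc (Suc n)) * y = U_scal (1 / ?q) * (U_gen i * (divpow i (Suc n) * y))" for y
    by (simp add: divpow_Suc[of i "Suc n"] mult.assoc)
  have h: "U_gen i * (divpow i n * x) = U_scal (qint (Suc n)) * (divpow i (Suc n) * x)"
    by (simp only: mult.assoc[symmetric] gen_mult_divpow)
  have "U_lder i (divpow i (Suc (Suc n)) * x) =
      U_scal (1 / ?q) * (divpow i (Suc n) * x
        + U_scal (vv ^ 2) * (U_scal (vv ^ n * qint (Suc n)) * (divpow i (Suc n) * x)
        + U_scal (vv ^ (2 * Suc n)) * (U_gen i * (divpow i (Suc n) * U_lder i x))))"
    unfolding e U_lder_scal U_lder_gen_mult Suc distrib_left[of "U_gen i"] U_scal_left_commute[of "U_gen i"] h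
    by (simp only: cart_def U_scal_scal) simp
  also have "\<dots> = U_scal (1 / ?q) *
        (U_scal (1 + vv ^ Suc (Suc n) * qint (Suc n)) * (divpow i (Suc n) * x))
      + U_scal (vv ^ (2 * Suc (Suc n))) *
        (U_scal (1 / ?q) * (U_gen i * (divpow i (Suc n) * U_lder i x)))"
    unfolding distrib_left U_scal_scal U_scal_add distrib_right U_scal_1 mult_1
    by (simp add: power2_eq_square add.assoc ac_simps)
  also have "U_scal (1 / ?q) * (U_scal (1 + vv ^ Suc (Suc n) * qint (Suc n)) * (divpow i (Suc n) * x))
      = U_scal (vv ^ Suc n) * (divpow i (Suc n) * x)"
    unfolding U_scal_scal qint_Suc[symmetric] by (simp add: qint_nonzero)
  finally show ?case unfolding e .
qed

lemma U_lder_divpow_other: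
  assumes "i \<noteq> j"
  shows "U_lder i (divpow j n * x) = U_scal (vv powi (- 2 * int n)) * (divpow j n * U_lder i x)"
proof (induction n)
  case (Suc n)
  have e: "divpow j (Suc n) * y = U_scal (1 / qint (Suc n)) * (U_gen j * (divpow j n * y))" for y
    by (simp add: divpow_Suc mult.assoc)
  have "vv powi (- 2) * vv powi (- 2 * int n) = vv powi (- 2 * int (Suc n))"
    using power_int_add[of vv "- 2" "- 2 * int n"] by (simp add: algebra_simps)
  then show ?case
    using assms unfolding e U_lder_scal U_lder_gen_mult Suc
    by (simp add: cart_def U_scal_left_commute[of "U_gen j"] U_scal_scal mult.commute)
qed simp

lemma U_form_divpow_Suc:
  "U_form (divpow i (Suc n) * x) y = inverse vv ^ n * geo (Suc n) * U_form (divpow i n * x) (U_lder i y)"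
proof -
  have "U_form (divpow i (Suc n) * x) y =
      gen_norm / qint (Suc n) * U_form (divpow i n * x) (U_lder i y)"
    by (simp add: divpow_Suc mult.assoc U_form_scal_left U_form_gen_left)
  then show ?thesis by (simp only: gen_norm_divide_qint)
qed

text \<open>
  The norm \<open>(E\<^bsup>(n)\<^esup>, E\<^bsup>(n)\<^esup>)\<close> of a divided power.
\<close>

definition phi :: "nat \<Rightarrow> qv" where
  "phi n = (\<Prod>k=1..n. geo k)"

lemma phi_0 [simp]: "phi 0 = 1" and phi_Suc: "phi (Suc n) = geo (Suc n) * phi n"
  by (simp_all add: phi_def mult.commute)

lemma near_one_phi: "near_one (phi n)"
  by (induction n) (simp_all add: phi_Suc near_one_mult near_one_geo)

lemma phi_ge_1: "1 \<le> phi n"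
proof (induction n)
  case (Suc n)
  then show ?case using mult_mono[of 1 "geo (Suc n)" 1 "phi n"] geo_ge_1[of "Suc n"]
    by (simp add: phi_Suc)
qed simp

text \<open>
  On a vector \<open>y\<close> of the kernel of \<open>\<^sub>ir\<close> the derivation only lowers the divided power in front, so
  \<open>E\<^sub>i\<^bsup>(n)\<^esup>\<close> acts as an isometry up to the norm of \<open>E\<^sub>i\<^bsup>(n)\<^esup>\<close>.
\<close>

lemma U_form_divpow_ker:
  assumes "U_lder i y = 0"
  shows "U_form (divpow i n * x) (divpow i n * y) = phi n * U_form x y"
proof (induction n)
  case (Suc n)
  have "inverse vv ^ n * vv ^ n = 1" by (simp flip: power_mult_distrib)
  then show ?case
    using assms Suc
    by (simp add: U_form_divpow_Suc U_lder_divpow_same U_form_scal_right phi_Suc)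
qed simp

section \<open>Monomials in three divided powers\<close>

definition sandwich :: "node \<Rightarrow> node \<Rightarrow> nat \<Rightarrow> nat \<Rightarrow> nat \<Rightarrow> uplus" where
  "sandwich i j b m n = divpow i m * (divpow j b * divpow i n)"

lemma U_lder_divpow:
  "U_lder i (divpow i n) = (case n of 0 \<Rightarrow> 0 | Suc n' \<Rightarrow> U_scal (vv ^ n') * divpow i n')"
  using U_lder_divpow_same[of i "n - 1" 1] by (cases n) simp_all

lemma U_lder_divpow_eq_0: "i \<noteq> j \<Longrightarrow> U_lder i (divpow j n) = 0"
  using U_lder_divpow_other[of i j n 1] by simp

text \<open>
  Passing \<open>\<^sub>ir\<close> across \<open>E\<^sub>i\<^bsup>(m)\<^esup>\<close> contributes \<open>v\<^bsup>2m\<^esup>\<close> and across \<open>E\<^sub>j\<^bsup>(b)\<^esup>\<close> contributes \<open>v\<^bsup>-2b\<^esup>\<close>; the negative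
  entry of the Cartan matrix is what makes a large \<open>b\<close> suppress the second term.
\<close>

lemma U_lder_sandwich:
  assumes "i \<noteq> j"
  shows "U_lder i (sandwich i j b m n) =
    (case m of 0 \<Rightarrow> 0 | Suc m' \<Rightarrow> U_scal (vv ^ m') * sandwich i j b m' n) +
    (case n of 0 \<Rightarrow> 0 | Suc n' \<Rightarrow>
       U_scal (vv powi (2 * int m - 2 * int b + int n')) * sandwich i j b m n')"
proof -
  have pow: "vv powi - (2 * int b) * vv ^ k = vv powi (int k - 2 * int b)" for k
    by (simp only: vv_power vv_powi_mult) simp
  have inner: "U_lder i (divpow j b * divpow i n) = (case n of 0 \<Rightarrow> 0 | Suc n' \<Rightarrow>
      U_scal (vv powi (- 2 * int b + int n')) * (divpow j b * divpow i n'))"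
    by (cases n) (simp_all add: U_lder_divpow_other[OF assms] U_lder_divpow
        U_scal_left_commute[of "divpow j b"] U_scal_scal pow
        U_lder_divpow_eq_0[OF assms])
  have outer: "U_lder i (divpow i m * x) =
      (case m of 0 \<Rightarrow> 0 | Suc m' \<Rightarrow> U_scal (vv ^ m') * (divpow i m' * x)) +
      U_scal (vv powi (2 * int m)) * (divpow i m * U_lder i x)" for x
    by (cases m) (simp_all add: U_lder_divpow_same power_int_def nat_add_distrib nat_mult_distrib)
  have "2 * int m + (- 2 * int b + k) = 2 * int m - 2 * int b + k" for k by simp
  then show ?thesis
    unfolding sandwich_def outer inner
    by (cases n) (simp_all only: nat.case U_scal_left_commute[of "divpow i m"] U_scal_scal
        vv_powi_mult mult_zero_right)
qed

text \<open>
  Two monomials of the same degree, the second with \<open>d\<close> more factors \<open>E\<^sub>i\<close> on the left, are paired,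
  and the power of \<open>v\<close> that the pairing has when \<open>m + k \<le> 2b\<close> is divided out. With this normalisation
  the weights in the recursion do not depend on \<open>d\<close>.
\<close>

definition overlap :: "node \<Rightarrow> node \<Rightarrow> nat \<Rightarrow> nat \<Rightarrow> nat \<Rightarrow> nat \<Rightarrow> qv" where
  "overlap i j b m k d = vv powi (- (int d * (int m + int k - 2 * int b))) *
     U_form (sandwich i j b m (k + d)) (sandwich i j b (m + d) k)"

lemma U_form_sandwich:
  "U_form (sandwich i j b m (k + d)) (sandwich i j b (m + d) k) =
     vv powi (int d * (int m + int k - 2 * int b)) * overlap i j b m k d"
  by (simp add: overlap_def mult.assoc[symmetric] flip: power_int_add)

lemma U_form_sandwich_Suc:
  "U_form (sandwich i j b (Suc m) n) y =
     inverse vv ^ m * geo (Suc m) * U_form (sandwich i j b m n) (U_lder i y)"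
  by (simp add: sandwich_def U_form_divpow_Suc)

text \<open>
  The first monomial has no factor \<open>E\<^sub>i\<close> on its left. Moving those of the second monomial across
  the form one by one, \<open>\<^sub>ir\<close> has a single term at every step, and only norms remain.
\<close>

lemma overlap_0:
  assumes "i \<noteq> j"
  shows "overlap i j b 0 k d = phi d * phi b * phi k"
proof -
  have base: "U_form (sandwich i j b 0 k) (sandwich i j b 0 k) = phi b * phi k"
    using U_form_divpow_ker[of j "divpow i k" b "divpow i k"]
      U_form_divpow_ker[of i 1 k 1] assms U_lder_divpow_eq_0[of j i k]
    by (simp add: sandwich_def)
  have "U_form (sandwich i j b d k) (sandwich i j b 0 (k + d)) =
      vv powi (int d * (int k - 2 * int b)) * (phi d * phi b * phi k)"
  proof (induction d)
    case 0
    then show ?case by (simp add: base)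
  next
    case (Suc d)
    have "inverse vv ^ d * vv powi (- 2 * int b + int (k + d)) * vv powi (int d * (int k - 2 * int b))
        = vv powi (int (Suc d) * (int k - 2 * int b))"
      unfolding inverse_vv_power vv_powi_mult by (simp add: algebra_simps)
    then show ?case
      by (simp add: U_form_sandwich_Suc U_lder_sandwich[OF assms] U_form_scal_right Suc phi_Suc)
  qed
  then show ?thesis
    by (simp add: overlap_def U_form_commute[of "sandwich i j b 0 _"] mult.assoc[symmetric]
        flip: power_int_add)
qed

lemma overlap_Suc_0:
  assumes "i \<noteq> j"
  shows "overlap i j b (Suc m) 0 d = geo (Suc m) * overlap i j b m 0 d"
proof -
  let ?e = "int d * (int (Suc m) + int 0 - 2 * int b)"
  have e: "inverse vv ^ m * vv ^ (m + d) * vv powi (int d * (int m - 2 * int b)) = vv powi ?e"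
    unfolding inverse_vv_power vv_power vv_powi_mult by (simp add: algebra_simps)
  have "U_form (sandwich i j b (Suc m) (0 + d)) (sandwich i j b (Suc m + d) 0) =
      (inverse vv ^ m * vv ^ (m + d) * vv powi (int d * (int m - 2 * int b))) *
      (geo (Suc m) * overlap i j b m 0 d)"
    using U_form_sandwich[of i j b m 0 d]
    by (simp add: U_form_sandwich_Suc U_lder_sandwich[OF assms] U_form_scal_right)
  then show ?thesis
    unfolding e overlap_def[of i j b "Suc m"] by (simp add: mult.assoc[symmetric] vv_powi_mult)
qed

text \<open>
  The leftmost \<open>E\<^sub>i\<close> of the first monomial is cancelled by \<open>\<^sub>ir\<close> against one on the left of the second
  monomial (first summand) or against one on its right (second summand, which raises the
  imbalance \<open>d\<close>).
\<close>

lemma overlap_Suc_Suc: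
  assumes "i \<noteq> j"
  shows "overlap i j b (Suc m) (Suc k) d = geo (Suc m) *
    (overlap i j b m (Suc k) d +
     vv powi (2 * (int m + int k + 1 - 2 * int b)) * overlap i j b m k (Suc d))"
proof -
  let ?e = "int d * (int (Suc m) + int (Suc k) - 2 * int b)"
  \<comment> \<open>Exponents of \<open>v\<close>: the first summand has exactly the normalising exponent, the second exceeds it
    by the weight.\<close>
  have e1: "inverse vv ^ m * vv ^ (m + d) *
      vv powi (int d * (int m + int (Suc k) - 2 * int b)) = vv powi ?e"
    unfolding inverse_vv_power vv_power vv_powi_mult by (simp add: algebra_simps)
  have e2: "inverse vv ^ m * vv powi (2 * int (Suc m + d) - 2 * int b + int k) *
      vv powi (int (Suc d) * (int m + int k - 2 * int b)) =
      vv powi ?e * vv powi (2 * (int m + int k + 1 - 2 * int b))"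
    unfolding inverse_vv_power vv_power vv_powi_mult by (simp add: algebra_simps)
  have "U_lder i (sandwich i j b (Suc m + d) (Suc k)) =
      U_scal (vv ^ (m + d)) * sandwich i j b (m + d) (Suc k) +
      U_scal (vv powi (2 * int (Suc m + d) - 2 * int b + int k)) * sandwich i j b (Suc m + d) k"
    by (simp add: U_lder_sandwich[OF assms])
  then have "U_form (sandwich i j b (Suc m) (Suc k + d)) (sandwich i j b (Suc m + d) (Suc k)) =
      inverse vv ^ m * geo (Suc m) *
      (vv ^ (m + d) * (vv powi (int d * (int m + int (Suc k) - 2 * int b)) * overlap i j b m (Suc k) d) +
       vv powi (2 * int (Suc m + d) - 2 * int b + int k) *
         (vv powi (int (Suc d) * (int m + int k - 2 * int b)) * overlap i j b m k (Suc d)))"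
    using U_form_sandwich[of i j b m "Suc k" d] U_form_sandwich[of i j b m k "Suc d"]
    by (simp only: U_form_sandwich_Suc U_form_add_right U_form_scal_right add_Suc_right add_Suc)
  also have "\<dots> = geo (Suc m) *
      ((inverse vv ^ m * vv ^ (m + d) * vv powi (int d * (int m + int (Suc k) - 2 * int b))) *
         overlap i j b m (Suc k) d +
       (inverse vv ^ m * vv powi (2 * int (Suc m + d) - 2 * int b + int k) *
         vv powi (int (Suc d) * (int m + int k - 2 * int b))) * overlap i j b m k (Suc d))"
    by (simp only: distrib_left ac_simps)
  also have "\<dots> = vv powi ?e * (geo (Suc m) *
    (overlap i j b m (Suc k) d +
     vv powi (2 * (int m + int k + 1 - 2 * int b)) * overlap i j b m k (Suc d)))"
    unfolding e1 e2 by (simp only: distrib_left ac_simps)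
  finally show ?thesis
    unfolding overlap_def[of i j b "Suc m"] by (simp add: mult.assoc[symmetric] vv_powi_mult)
qed

text \<open>
  In each step \<open>m + k + 1 < 2b\<close> for the smaller \<open>m\<close> and \<open>k\<close>, so the second summand of the recursion
  carries a negative power of \<open>v\<close>.
\<close>

lemma near_one_overlap:
  assumes "i \<noteq> j" "m + k \<le> 2 * b"
  shows "near_one (overlap i j b m k d)"
  using assms(2)
proof (induction m arbitrary: k d)
  case 0
  show ?case by (simp add: overlap_0[OF assms(1)] near_one_mult near_one_phi)
next
  case (Suc m)
  show ?case
  proof (cases k)
    case 0
    then show ?thesis
      using Suc by (simp add: overlap_Suc_0[OF assms(1)] near_one_mult near_one_geo)
  next
    case (Suc k')
    then show ?thesis
      using Suc.IH Suc.prems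
      by (simp add: overlap_Suc_Suc[OF assms(1)] near_one_mult near_one_geo near_one_add_powi)
  qed
qed

text \<open>
  The second summand of the recursion is positive whatever its weight, so the first summand alone
  carries the bound from \<open>m\<close> to \<open>m + 1\<close>.
\<close>

lemma overlap_ge_1:
  assumes "i \<noteq> j"
  shows "1 \<le> overlap i j b m k d"
proof (induction m arbitrary: k d)
  case 0
  have "1 * 1 * 1 \<le> phi d * phi b * phi k"
    using phi_ge_1 by (intro mult_mono) (simp_all add: order.trans[OF zero_le_one phi_ge_1])
  then show ?case by (simp add: overlap_0[OF assms])
next
  case (Suc m)
  have geo: "1 * 1 \<le> geo (Suc m) * x" if "1 \<le> x" for x
    using that geo_ge_1[of "Suc m"] by (intro mult_mono) simp_all
  show ?case
  proof (cases k)
    case 0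
    then show ?thesis
      using geo[OF Suc] by (simp add: overlap_Suc_0[OF assms])
  next
    case (Suc k')
    have "0 \<le> vv powi (2 * (int m + int k' + 1 - 2 * int b)) * overlap i j b m k' (Suc d)"
      using Suc.IH[of k' "Suc d"] vv_gt_1 by simp
    then have "1 \<le> overlap i j b m (Suc k') d +
        vv powi (2 * (int m + int k' + 1 - 2 * int b)) * overlap i j b m k' (Suc d)"
      using Suc.IH[of "Suc k'" d] by linarith
    from geo[OF this] Suc show ?thesis
      by (simp add: overlap_Suc_Suc[OF assms])
  qed
qed

text \<open>
  One step of the recursion is available because \<open>m\<close> and \<open>k\<close> are positive. Its weight is
  \<open>v\<^bsup>2(m+k-1-2b)\<^esup> \<ge> 1\<close>, so both summands are at least \<open>1\<close>.
\<close>

lemma overlap_ge_2: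
  assumes "i \<noteq> j" "m > 0" "k > 0" "2 * b < m + k"
  shows "2 \<le> overlap i j b m k d"
proof -
  from assms obtain m' k' where mk: "m = Suc m'" "k = Suc k'"
    by (metis gr0_implies_Suc)
  have "1 \<le> vv powi (2 * (int m' + int k' + 1 - 2 * int b))"
    using vv_gt_1 assms mk by (intro one_le_power_int) auto
  then have "1 * 1 \<le> vv powi (2 * (int m' + int k' + 1 - 2 * int b)) * overlap i j b m' k' (Suc d)"
    using overlap_ge_1[OF assms(1)] by (intro mult_mono) auto
  then have "2 \<le> overlap i j b m' (Suc k') d +
      vv powi (2 * (int m' + int k' + 1 - 2 * int b)) * overlap i j b m' k' (Suc d)"
    using overlap_ge_1[OF assms(1), of b m' "Suc k'" d] by linarith
  then have "1 * 2 \<le> geo (Suc m') * (overlap i j b m' (Suc k') d +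
      vv powi (2 * (int m' + int k' + 1 - 2 * int b)) * overlap i j b m' k' (Suc d))"
    using geo_ge_1[of "Suc m'"] by (intro mult_mono) auto
  then show ?thesis
    by (simp add: mk overlap_Suc_Suc[OF assms(1)])
qed

section \<open>Left divisibility\<close>

lemma qfact_nonzero: "qfact n \<noteq> 0"
  by (induction n) (simp_all add: qfact_def qint_nonzero)

lemma gen_power: "U_gen i ^ n = U_scal (qfact n) * divpow i n"
  by (simp add: divpow_def U_scal_scal qfact_nonzero)

text \<open>
  If \<open>E\<^sub>i\<^bsup>(n)\<^esup> x\<close> were \<open>E\<^sub>i\<^bsup>n+1\<^esup> z\<close>, pairing both expressions with \<open>E\<^sub>i\<^bsup>(n)\<^esup> u\<close> would give a nonzero multiple
  of \<open>(x, u)\<close> and a multiple of \<open>(E\<^sub>i z, u)\<close>, which vanishes since \<open>\<^sub>ir\<close> kills \<open>u\<close>.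
\<close>

lemma divpow_mult_notin_range:
  assumes "U_lder i u = 0" "U_form x u \<noteq> 0"
  shows "divpow i n * x \<notin> range ((*) (U_gen i ^ Suc n))"
proof
  assume "divpow i n * x \<in> range ((*) (U_gen i ^ Suc n))"
  then obtain z where "divpow i n * x = U_gen i ^ Suc n * z" by blast
  also have "\<dots> = U_scal (qfact n) * (divpow i n * (U_gen i * z))"
    by (simp only: power_Suc2 mult.assoc) (simp add: gen_power mult.assoc)
  finally have "U_form (divpow i n * x) (divpow i n * u) = 0"
    using assms(1) by (simp add: U_form_scal_left U_form_divpow_ker U_form_gen_left)
  then show False
    using assms phi_ge_1[of n] by (simp add: U_form_divpow_ker)
qed

text \<open>
  The summand for \<open>n = 0\<close> is \<open>E\<^sub>j\<^bsup>(b)\<^esup> E\<^sub>i\<^bsup>(c)\<^esup>\<close> and all others lie in \<open>E\<^sub>i U\<close>. The coefficients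
  are those for which the terms of \<open>\<^sub>ir\<close> of consecutive summands cancel. This is the element that
  appears in Lusztig's higher order quantum Serre relations.
\<close>

definition ker_vec :: "node \<Rightarrow> node \<Rightarrow> nat \<Rightarrow> nat \<Rightarrow> uplus" where
  "ker_vec i j b c = (\<Sum>n\<le>c. U_scal ((-1) ^ n * vv powi (int n * (int c - 2 * int b - 1))) *
     sandwich i j b n (c - n))"

lemma U_lder_ker_vec:
  assumes "i \<noteq> j"
  shows "U_lder i (ker_vec i j b c) = 0"
proof (cases c)
  case 0
  then show ?thesis
    by (simp add: ker_vec_def U_lder_sandwich[OF assms])
next
  case (Suc c')
  define k where "k n = (-1) ^ n * vv powi (int n * (int c - 2 * int b - 1))" for n
  \<comment> \<open>The two terms of \<open>\<^sub>ir\<close>; the first at \<open>n + 1\<close> cancels the second at \<open>n\<close>.\<close>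
  let ?A = "\<lambda>n. case n of 0 \<Rightarrow> 0 | Suc m \<Rightarrow> U_scal (k n * vv ^ m) * sandwich i j b m (c - n)"
  let ?B = "\<lambda>n. case c - n of 0 \<Rightarrow> 0 | Suc r \<Rightarrow>
      U_scal (k n * vv powi (2 * int n - 2 * int b + int r)) * sandwich i j b n r"
  have cancel: "k (Suc n) * vv ^ n + k n * vv powi (2 * int n - 2 * int b + int (c' - n)) = 0"
    if "n \<le> c'" for n
  proof -
    have "vv powi (int (Suc n) * (int c - 2 * int b - 1)) * vv ^ n =
        vv powi (int n * (int c - 2 * int b - 1)) * vv powi (2 * int n - 2 * int b + int (c' - n))"
      unfolding vv_power vv_powi_mult using that by (simp add: Suc of_nat_diff algebra_simps)
    then show ?thesis by (simp add: k_def)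
  qed
  have "U_lder i (U_scal (k n) * sandwich i j b n (c - n)) = ?A n + ?B n" for n
    unfolding U_lder_scal U_lder_sandwich[OF assms]
    by (simp add: distrib_left U_scal_scal split: nat.split)
  moreover have "ker_vec i j b c = (\<Sum>n\<le>c. U_scal (k n) * sandwich i j b n (c - n))"
    by (simp only: ker_vec_def k_def)
  ultimately have "U_lder i (ker_vec i j b c) = (\<Sum>n\<le>c. ?A n) + (\<Sum>n\<le>c. ?B n)"
    by (simp only: U_lder_sum sum.distrib)
  also have "(\<Sum>n\<le>c. ?A n) = (\<Sum>n\<le>c'. U_scal (k (Suc n) * vv ^ n) * sandwich i j b n (c' - n))"
    unfolding Suc sum.atMost_Suc_shift by simp
  also have "(\<Sum>n\<le>c. ?B n) = (\<Sum>n\<le>c'.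
      U_scal (k n * vv powi (2 * int n - 2 * int b + int (c' - n))) * sandwich i j b n (c' - n))"
    by (simp add: Suc Suc_diff_le)
  also have "(\<Sum>n\<le>c'. U_scal (k (Suc n) * vv ^ n) * sandwich i j b n (c' - n)) + \<dots> = 0"
    by (simp only: sum.distrib[symmetric] distrib_right[symmetric] U_scal_add[symmetric])
      (intro sum.neutral ballI, simp only: cancel atMost_iff U_scal_0 mult_zero_left)
  finally show ?thesis .
qed

lemma near_one_sum:
  assumes "near_one (f 0)" "\<And>n. n < K \<Longrightarrow> \<exists>y\<in>reg_inf. f (Suc n) = inverse vv * y"
  shows "near_one (\<Sum>n\<le>K. f n)"
  using assms(2)
proof (induction K)
  case (Suc K)
  then have "near_one (\<Sum>n\<le>K. f n)" by simp
  moreover obtain y where "y \<in> reg_inf" "f (Suc K) = inverse vv * y" using Suc(2)[of K] by blast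
  ultimately show ?case by (simp add: near_one_add)
qed (simp add: assms)

text \<open>
  The summand with index \<open>n\<close> contributes an element near one times \<open>\<plusminus>v\<close> to the power
  \<open>n (2 (c - 2b) - 1 - n)\<close>, which is negative for \<open>n > 0\<close>. So the summand \<open>n = 0\<close>
  dominates and the alternating signs cannot produce a cancellation.
\<close>

lemma U_form_ker_vec:
  assumes "i \<noteq> j" "c \<le> 2 * b"
  shows "near_one (U_form (sandwich i j b 0 c) (ker_vec i j b c))"
proof -
  let ?t = "\<lambda>n. (-1) ^ n * vv powi (int n * (2 * (int c - 2 * int b) - 1 - int n)) *
      overlap i j b 0 (c - n) n"
  have near: "near_one (overlap i j b 0 k n)" for k n
    by (simp add: overlap_0[OF assms(1)] near_one_mult near_one_phi)
  have summand: "U_form (sandwich i j b 0 c)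
      (U_scal ((-1) ^ n * vv powi (int n * (int c - 2 * int b - 1))) * sandwich i j b n (c - n)) = ?t n"
    if "n \<le> c" for n
  proof -
    have e: "vv powi (int n * (int c - 2 * int b - 1)) * vv powi (int n * (int (c - n) - 2 * int b)) =
        vv powi (int n * (2 * (int c - 2 * int b) - 1 - int n))"
      unfolding vv_powi_mult using that by (simp add: of_nat_diff algebra_simps)
    have h: "U_form (sandwich i j b 0 c) (sandwich i j b n (c - n)) =
        vv powi (int n * (int (c - n) - 2 * int b)) * overlap i j b 0 (c - n) n"
      using U_form_sandwich[of i j b 0 "c - n" n] that by simp
    show ?thesis
      unfolding U_form_scal_right h e[symmetric] by (simp only: mult.assoc)
  qed
  have "near_one (\<Sum>n\<le>c. ?t n)"
  proof (rule near_one_sum)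
    show "near_one (?t 0)" using near by simp
  next
    fix n assume "n < c"
    let ?e = "int (Suc n) * (2 * (int c - 2 * int b) - 1 - int (Suc n))"
    have "2 * (int c - 2 * int b) - 1 - int (Suc n) < 0" using assms by simp
    then have "?e < 0" by (intro mult_pos_neg) simp_all
    then obtain y where y: "y \<in> reg_inf" "vv powi ?e = inverse vv * y"
      using vv_powi_reg_inf by blast
    have "(-1) ^ Suc n * (y * overlap i j b 0 (c - Suc n) (Suc n)) \<in> reg_inf"
      by (intro reg_inf_mult reg_inf_power reg_inf_minus y near_one_reg_inf[OF near]) simp
    moreover have "?t (Suc n) = inverse vv * ((-1) ^ Suc n * (y * overlap i j b 0 (c - Suc n) (Suc n)))"
      unfolding y(2) by (simp only: ac_simps)
    ultimately show "\<exists>y\<in>reg_inf. ?t (Suc n) = inverse vv * y" by (rule bexI[rotated])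
  qed
  also have "(\<Sum>n\<le>c. ?t n) = U_form (sandwich i j b 0 c) (ker_vec i j b c)"
    unfolding ker_vec_def U_form_sum_right by (rule sum.cong) (simp_all only: atMost_iff summand[symmetric])
  finally show ?thesis .
qed

section \<open>Membership in the canonical basis\<close>

lemma signed_basis_iff:
  "x \<in> signed_basis \<longleftrightarrow> x \<in> U_int \<and> U_bar x = x \<and> near_one (U_form x x)"
  by (simp add: signed_basis_def near_one_def)

lemma one_in_signed_basis: "1 \<in> signed_basis"
  using U_int.divpow[of N1 0] by (simp add: signed_basis_iff)

lemma canonical_basis_subset_signed: "x \<in> canonical_basis \<Longrightarrow> x \<in> signed_basis"
  by (induction rule: canonical_basis.induct)
    (auto simp: one_in_signed_basis lusztig_pi_def signed_basis_at_def)

text \<open>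
  The situation in which Lusztig's bijection \<open>\<pi>\<^bsub>i,n\<^esub>\<close> is multiplication by \<open>E\<^sub>i\<^bsup>(n)\<^esup>\<close> on the nose: the
  product is already a signed basis element, and \<open>u\<close> witnesses that both elements have the exact
  left divisibility by \<open>E\<^sub>i\<close> that is required.
\<close>

lemma canonical_basis_divpow_mult:
  assumes x: "x \<in> canonical_basis"
    and u: "U_lder i u = 0" "U_form x u \<noteq> 0"
    and near: "near_one (U_form (divpow i n * x) (divpow i n * x))"
  shows "divpow i n * x \<in> canonical_basis"
proof (cases "n = 0")
  case True
  with x show ?thesis by simp
next
  case False
  let ?y = "divpow i n * x"
  have xs: "x \<in> signed_basis" using x by (rule canonical_basis_subset_signed)
  then have ys: "?y \<in> signed_basis"
    using near by (auto simp: signed_basis_iff U_bar_mult U_bar_divpow intro: U_int.intros)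
  have "x \<in> signed_basis_at i 0"
    using xs divpow_mult_notin_range[OF u, of 0] by (simp add: signed_basis_at_def)
  moreover have "?y = U_gen i ^ n * (U_scal (1 / qfact n) * x)"
    by (simp add: divpow_def U_scal_left_commute[of "U_gen i ^ n"] mult.assoc)
  then have "?y \<in> signed_basis_at i n"
    using ys divpow_mult_notin_range[OF u, of n] unfolding signed_basis_at_def by blast
  moreover have "?y - ?y \<in> range ((*) (U_gen i ^ Suc n))"
    by (rule range_eqI[of _ _ 0]) simp
  ultimately have "lusztig_pi i n x ?y" by (simp add: lusztig_pi_def)
  then show ?thesis using False x canonical_basis.step by blast
qed

lemma sandwich_in_canonical_basis:
  assumes "i \<noteq> j" "a + c \<le> 2 * b"
  shows "sandwich i j b a c \<in> canonical_basis"
proof -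
  have nz: "U_form (divpow i c) (divpow i c) = phi c"
    using U_form_divpow_ker[of i 1 c 1] by simp
  have "divpow i c * 1 \<in> canonical_basis"
    by (rule canonical_basis_divpow_mult[of _ _ 1])
      (simp_all add: canonical_basis.one nz near_one_phi)
  then have "divpow i c \<in> canonical_basis" by simp
  moreover have "U_lder j (divpow i c) = 0" using assms by (simp add: U_lder_divpow_eq_0)
  ultimately have "sandwich i j b 0 c \<in> canonical_basis"
    unfolding sandwich_def divpow_0 mult_1
    using near_one_nonzero[OF near_one_phi]
    by (intro canonical_basis_divpow_mult[of "divpow i c" _ "divpow i c"])
      (simp_all add: nz U_form_divpow_ker near_one_mult near_one_phi)
  moreover have "near_one (U_form (sandwich i j b a c) (sandwich i j b a c))"
    using near_one_overlap[OF assms, of 0] U_form_sandwich[of i j b a c 0] by simp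
  moreover have "U_form (sandwich i j b 0 c) (ker_vec i j b c) \<noteq> 0"
    using assms by (intro near_one_nonzero U_form_ker_vec) simp_all
  moreover have "sandwich i j b a c = divpow i a * sandwich i j b 0 c"
    by (simp add: sandwich_def)
  ultimately show ?thesis
    using canonical_basis_divpow_mult[OF _ U_lder_ker_vec[OF assms(1)]] by simp
qed

lemma sandwich_notin_canonical_basis:
  assumes "i \<noteq> j" "a > 0" "c > 0" "2 * b < a + c"
  shows "sandwich i j b a c \<notin> canonical_basis"
proof
  assume "sandwich i j b a c \<in> canonical_basis"
  then have "near_one (U_form (sandwich i j b a c) (sandwich i j b a c))"
    using canonical_basis_subset_signed by (auto simp: signed_basis_iff)
  then have "overlap i j b a c 0 < 2"
    using U_form_sandwich[of i j b a c 0] near_one_less_2 by simp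
  then show False using overlap_ge_2[OF assms, of 0] by simp
qed

theorem lemma6p3:
  fixes i1 i2 i3 :: node and a b c :: nat
  assumes "(i1, i2, i3) \<in> {(N1, N2, N1), (N2, N1, N2)}"
    and "a > 0" and "b > 0" and "c > 0"
  shows "tight [(i1, a), (i2, b), (i3, c)] \<longleftrightarrow> 2 * b \<ge> a + c"
proof -
  from assms have i: "i1 \<noteq> i2" "i3 = i1" by auto
  have "monomial [(i1, a), (i2, b), (i3, c)] = sandwich i1 i2 b a c"
    by (simp add: monomial_def sandwich_def i)
  then show ?thesis
    using sandwich_in_canonical_basis[OF i(1)] sandwich_notin_canonical_basis[OF i(1) assms(2,4)]
    unfolding tight_def by (metis not_le)
qed

end
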